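(* Let $F\colon\mathbb{F}_{2^n}\to\mathbb{F}_{2^4}$ be a bent function. Then there are only 14 possible preimage distributions for $F$, which are the distributions with preimage set sizes $X_i=2^{n-4}+2^{n/2-4}(2T_i-1)$, $i=1,\dots,16$, where the $T_i$ are one of the following (up to reordering): 1. $T_1=-6$, $T_2=\dots=T_9=0$, $T_{10}=\dots=T_{16}=2$; 2. $T_1=-4$, $T_2=T_3=-2$, $T_4=\dots=T_9=0$, $T_{10}=\dots=T_{15}=2$, $T_{16}=4$; 3. $T_1=-4$, $T_2=\dots=T_{13}=0$, $T_{14}=T_{15}=T_{16}=4$; 4. $T_1=\dots=T_6=-2$, $T_7=\dots=T_{16}=2$; 5. $T_1=\dots=T_4=-2$, $T_5=\dots=T_{10}=0$, $T_{11}=\dots=T_{14}=2$, $T_{15}=T_{16}=4$; 6. $T_1=T_2=T_3=-2$, $T_4=\dots=T_{11}=0$, $T_{12}=\dots=T_{15}=2$, $T_{16}=6$; 7. $T_1=\dots=T_{15}=0$, $T_{16}=8$; 8. the symmetric solutions $\{-T_1+1,-T_2+1,\dots,-T_{16}+1\}$ for each of the 7 solutions above.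
   Context: A function $F\colon\mathbb{F}_{2^n}\to\mathbb{F}_{2^m}$ is bent (perfect nonlinear) if $|\{x: F(x+a)-F(x)=b\}|=2^{n-m}$ for all nonzero $a\in\mathbb{F}_{2^n}$ and all $b\in\mathbb{F}_{2^m}$. The preimage distribution of $F$ is the multiset $\{X_1,\dots,X_{2^m}\}$ of the sizes $|F^{-1}(\beta)|$, $\beta\in\mathbb{F}_{2^m}$. The theorem asserts that the preimage distribution of every such $F$ is one of the 14 listed. *)

theory Defs
  imports Complex_Main "HOL-Library.Multiset" "HOL-Library.Cardinality"
begin

text \<open>
  The field with \<open>2 ^ n\<close> elements is a type \<open>'a\<close> of sort \<open>{field, finite}\<close> with
  \<open>CARD('a) = 2 ^ n\<close>. Powers of two with exponents such as \<open>n - m\<close> or \<open>n / 2 - 4\<close> are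
  real powers, so that no parity or size condition on \<open>n\<close> is built in.
\<close>

definition bent :: "nat \<Rightarrow> nat \<Rightarrow> ('a::{field,finite} \<Rightarrow> 'b::{field,finite}) \<Rightarrow> bool" where
  "bent n m F \<longleftrightarrow>
     (\<forall>a b. a \<noteq> 0 \<longrightarrow> real (card {x. F (x + a) - F x = b}) = 2 powr (real n - real m))"

definition preimage_distribution :: "('a::finite \<Rightarrow> 'b::finite) \<Rightarrow> nat multiset" where
  "preimage_distribution F = {# card (F -` {\<beta>}). \<beta> \<in># mset_set UNIV #}"

definition basic_solutions :: "int multiset set" where
  "basic_solutions =
    {mset ([-6] @ replicate 8 0 @ replicate 7 2),
     mset ([-4] @ replicate 2 (-2) @ replicate 6 0 @ replicate 6 2 @ [4]),
     mset ([-4] @ replicate 12 0 @ replicate 3 4),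
     mset (replicate 6 (-2) @ replicate 10 2),
     mset (replicate 4 (-2) @ replicate 6 0 @ replicate 4 2 @ replicate 2 4),
     mset (replicate 3 (-2) @ replicate 8 0 @ replicate 4 2 @ [6]),
     mset (replicate 15 0 @ [8])}"

definition solutions :: "int multiset set" where
  "solutions = basic_solutions \<union> (\<lambda>T. {# - t + 1. t \<in># T #}) ` basic_solutions"

definition sizes_of_solution :: "nat \<Rightarrow> int multiset \<Rightarrow> real multiset" where
  "sizes_of_solution n T =
     {# 2 powr (real n - 4) + 2 powr (real n / 2 - 4) * (2 * real_of_int t - 1). t \<in># T #}"

end

theory Submission imports Defs "HOL-Computational_Algebra.Polynomial" begin

text \<open>
  Let \<open>\<psi>\<close> be the nontrivial additive character \<open>(-1)\<close> to the power of the trace on the codomain.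
  Bentness gives \<open>(\<Sum>x. \<psi> (a * F x))\<^sup>2 = 2 ^ n\<close> for \<open>a \<noteq> 0\<close>, so these character sums equal
  \<open>2 powr (n / 2) * \<epsilon> a\<close> with a sign \<open>\<epsilon> a\<close>. Putting \<open>\<epsilon> 0 = 1\<close> and inverting the transform
  shows \<open>2 * T b = (\<Sum>a. \<epsilon> a * \<psi> (a * b))\<close>. If \<open>\<epsilon>\<close> takes the value \<open>-1\<close> an even
  number of times, then \<open>T = 2 * u\<close> for an integer function \<open>u\<close> with sum 4 and square sum 16,
  and \<open>(-1) ^ u b = \<sigma> * \<psi> (c * b)\<close> for some \<open>\<sigma> = \<plusminus>1\<close> and \<open>c\<close>. Hence the sum of \<open>(-1) ^ u b\<close>
  is 0 or \<open>\<plusminus>16\<close>, and the sum of \<open>(-1) ^ u b * u b\<close> is \<open>\<plusminus>4\<close>; these four conditions leave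
  only the seven basic solutions. In the odd case, changing the sign of \<open>\<epsilon>\<close> away from 0 makes the
  number even and replaces \<open>T\<close> by \<open>1 - T\<close>.
\<close>

section \<open>Characteristic two and the trace character\<close>

lemma char_two_of_card:
  assumes "CARD('a::{field,finite}) = 2 ^ k"
  shows "(2::'a) = 0"
proof -
  \<comment> \<open>Translation by 1 permutes the field, so the number of elements vanishes in
    it.\<close>
  have "(\<Sum>x\<in>UNIV. x + 1 :: 'a) = (\<Sum>x\<in>UNIV. x)"
    by (rule sum.reindex_bij_witness[of _ "\<lambda>x. x - 1" "\<lambda>x. x + 1"]) auto
  then have "of_nat CARD('a) = (0::'a)"
    by (simp add: sum.distrib)
  then show ?thesis
    by (simp add: assms)
qed

text \<open>Multiplication by a nonzero \<open>x\<close> permutes the nonzero elements; comparing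
  their products gives Fermat's identity.\<close>

lemma power_card_eq_self:
  fixes x :: "'a::{field,finite}"
  shows "x ^ CARD('a) = x"
proof (cases "x = 0")
  case False
  have "x ^ card (UNIV - {0::'a}) * \<Prod>(UNIV - {0::'a}) = (\<Prod>y\<in>UNIV - {0}. x * y)"
    by (simp add: prod.distrib)
  also have "\<dots> = \<Prod>(UNIV - {0})"
    by (rule prod.reindex_bij_witness[of _ "\<lambda>y. y / x" "\<lambda>y. x * y"]) (use False in auto)
  finally have "x ^ card (UNIV - {0::'a}) = 1"
    by simp
  moreover have "CARD('a) = Suc (card (UNIV - {0::'a}))"
    by (rule card.remove) auto
  ultimately show ?thesis
    by (simp only: power_Suc mult_1_right)
qed (simp add: card_gt_0_iff)

locale sign_character =
  fixes \<psi> :: "'b::{field,finite} \<Rightarrow> int"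
  assumes add: "\<psi> (x + y) = \<psi> x * \<psi> y"
    and range: "\<psi> x \<in> {1, -1}"
    and nontrivial: "\<exists>x. \<psi> x \<noteq> 1"

text \<open>The absolute trace \<open>tr\<close> is additive and invariant under squaring, so its
  values lie in the prime field. It is not identically zero, since its degree is smaller than the
  number of field elements.\<close>

lemma exists_sign_character:
  assumes card: "CARD('b::{field,finite}) = 2 ^ k"
  shows "\<exists>\<psi> :: 'b \<Rightarrow> int. sign_character \<psi>"
proof -
  have two: "(2::'b) = 0"
    using card by (rule char_two_of_card)
  define tr where "tr x = (\<Sum>i<k. x ^ 2 ^ i)" for x :: 'b
  have sq_add: "(x + y)\<^sup>2 = x\<^sup>2 + y\<^sup>2" for x y :: 'b
    by (simp add: power2_sum two)
  have pow_Suc: "x ^ 2 ^ Suc i = (x ^ 2 ^ i)\<^sup>2" for x :: 'b and i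
    by (simp only: power_Suc2 power_mult)
  have "(x + y) ^ 2 ^ i = x ^ 2 ^ i + y ^ 2 ^ i" for x y :: 'b and i
    by (induction i) (simp_all add: pow_Suc sq_add del: power_Suc)
  then have tr_add: "tr (x + y) = tr x + tr y" for x y
    by (simp add: tr_def sum.distrib)
  have sq_sum: "(\<Sum>i<m. f i)\<^sup>2 = (\<Sum>i<m. (f i)\<^sup>2)" for f :: "nat \<Rightarrow> 'b" and m
    by (induction m) (simp_all add: sq_add)
  have "(tr x)\<^sup>2 = tr x" for x
  proof -
    \<comment> \<open>Squaring shifts the summands by one. The extra \<open>x\<close> restores the
      first one, and the new last one is again \<open>x\<close> by Fermat.\<close>
    have "(tr x)\<^sup>2 + x = (\<Sum>i<k. x ^ 2 ^ Suc i) + x"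
      by (simp add: tr_def sq_sum pow_Suc del: power_Suc)
    also have "\<dots> = (\<Sum>i<Suc k. x ^ 2 ^ i)"
      unfolding sum.lessThan_Suc_shift by simp
    also have "\<dots> = tr x + x"
      using power_card_eq_self[of x] by (simp add: tr_def card)
    finally show ?thesis
      by simp
  qed
  then have tr_range: "tr x = 0 \<or> tr x = 1" for x
    using mult_cancel_left2[of "tr x" "tr x"] by (simp add: power2_eq_square)
  have "\<exists>x. tr x \<noteq> 0"
  proof (rule ccontr)
    assume "\<not> ?thesis"
    then have all: "tr x = 0" for x
      by blast
    define p :: "'b poly" where "p = (\<Sum>i<k. monom 1 (2 ^ i))"
    have "k > 0"
    proof -
      have "card {0, 1 :: 'b} \<le> CARD('b)"
        by (rule card_mono) auto
      then show ?thesis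
        by (cases k) (auto simp: card)
    qed
    \<comment> \<open>Only \<open>i = 0\<close> contributes to the linear coefficient, so no
      cancellation can make \<open>p\<close> zero.\<close>
    have "coeff p 1 = (\<Sum>i<k. if i = 0 then 1 else 0)"
      unfolding p_def coeff_sum by (intro sum.cong) auto
    also have "\<dots> = 1"
      using \<open>k > 0\<close> by simp
    finally have "p \<noteq> 0"
      by auto
    have "degree p \<le> 2 ^ (k - 1)"
      unfolding p_def
      by (intro degree_sum_le) (auto simp: degree_monom_eq intro!: power_increasing)
    also have "\<dots> < (2::nat) ^ k"
      using \<open>k > 0\<close> by simp
    finally have "degree p < CARD('b)"
      by (simp add: card)
    moreover have "{x. poly p x = 0} = UNIV"
      using all by (simp add: p_def tr_def poly_sum poly_monom)
    ultimately show False
      using card_poly_roots_bound[OF \<open>p \<noteq> 0\<close>] by simp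
  qed
  then have "sign_character (\<lambda>x. if tr x = 0 then 1 else -1)"
  proof unfold_locales
    fix x y
    show "(if tr (x + y) = 0 then 1 else -1) =
        (if tr x = 0 then 1 else -1) * (if tr y = 0 then 1 else (-1::int))"
      using tr_range[of x] tr_range[of y] two by (auto simp: tr_add)
  qed auto
  then show ?thesis
    by blast
qed

section \<open>Orthogonality and the Walsh-Hadamard transform\<close>

context sign_character
begin

lemma zero [simp]: "\<psi> 0 = 1"
  using add[of 0 0] range[of 0] by auto

lemma mult_self [simp]: "\<psi> x * \<psi> x = 1"
  using range[of x] by auto

lemma uminus [simp]: "\<psi> (- x) = \<psi> x"
  using add[of x "- x"] range[of x] range[of "-x"] by auto

lemma diff: "\<psi> (x - y) = \<psi> x * \<psi> y"
  using add[of x "- y"] by simp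

lemma sum_mult_left: "(\<Sum>x\<in>UNIV. \<psi> (a * x)) = (if a = 0 then int CARD('b) else 0)"
proof (cases "a = 0")
  case False
  obtain z where "\<psi> z \<noteq> 1"
    using nontrivial by blast
  have "(\<Sum>x\<in>UNIV. \<psi> (a * x)) = (\<Sum>x\<in>UNIV. \<psi> x)"
    by (rule sum.reindex_bij_witness[of _ "\<lambda>x. x / a" "\<lambda>x. a * x"]) (use False in auto)
  moreover have "(\<Sum>x\<in>UNIV. \<psi> x) = 0"
  proof -
    have "(\<Sum>x\<in>UNIV. \<psi> x) = (\<Sum>x\<in>UNIV. \<psi> (z + x))"
      by (rule sum.reindex_bij_witness[of _ "\<lambda>x. z + x" "\<lambda>x. x - z"]) auto
    also have "\<dots> = \<psi> z * (\<Sum>x\<in>UNIV. \<psi> x)"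
      by (simp only: add sum_distrib_left)
    finally show ?thesis
      using \<open>\<psi> z \<noteq> 1\<close> by simp
  qed
  ultimately show ?thesis
    using False by simp
qed simp

text \<open>The Walsh-Hadamard transform. The ring is left open: signs are transformed over the
  integers, preimage sizes over the reals.\<close>

definition transform :: "('b \<Rightarrow> 'c) \<Rightarrow> 'b \<Rightarrow> 'c::comm_ring_1" where
  "transform f b = (\<Sum>a\<in>UNIV. f a * of_int (\<psi> (a * b)))"

text \<open>Fourier inversion by orthogonality; no conjugation appears because \<open>\<psi>\<close>
  takes values \<open>\<plusminus>1\<close>.\<close>

lemma transform_transform: "transform (transform f) c = of_nat CARD('b) * f c"
proof -
  have "transform (transform f) c
      = (\<Sum>b\<in>UNIV. \<Sum>a\<in>UNIV. f a * of_int (\<psi> (a * b) * \<psi> (b * c)))"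
    by (simp add: transform_def sum_distrib_right mult.assoc)
  also have "\<dots> = (\<Sum>a\<in>UNIV. \<Sum>b\<in>UNIV. f a * of_int (\<psi> ((a - c) * b)))"
    by (subst sum.swap) (simp only: diff left_diff_distrib mult.commute[of _ c])
  also have "\<dots> = (\<Sum>a\<in>UNIV. f a * of_int (\<Sum>b\<in>UNIV. \<psi> ((a - c) * b)))"
    by (simp add: sum_distrib_left)
  also have "\<dots> = (\<Sum>a\<in>UNIV. if a = c then of_nat CARD('b) * f a else 0)"
    by (intro sum.cong) (auto simp: sum_mult_left)
  finally show ?thesis
    by simp
qed

lemma transform_commute: "(\<Sum>b\<in>UNIV. transform f b * g b) = (\<Sum>a\<in>UNIV. f a * transform g a)"
  unfolding transform_def sum_distrib_left sum_distrib_right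
  by (subst sum.swap) (simp add: mult_ac)

lemma sum_transform: "(\<Sum>b\<in>UNIV. transform f b) = of_nat CARD('b) * f 0"
  using transform_transform[of f 0] by (simp add: transform_def[of _ 0])

text \<open>Parseval: the kernel is symmetric, so one transform moves across the product and
  inversion applies.\<close>

lemma sum_transform_squared:
  "(\<Sum>b\<in>UNIV. (transform f b)\<^sup>2) = of_nat CARD('b) * (\<Sum>a\<in>UNIV. (f a)\<^sup>2)"
  using transform_commute[of f "transform f"]
  by (simp add: transform_transform power2_eq_square sum_distrib_left mult_ac)


text \<open>For signs with \<open>f 0 = 1\<close> the new function negates \<open>f\<close> away
  from 0; a point mass at 0 has constant transform.\<close>

lemma transform_flip:
  fixes f :: "'b \<Rightarrow> 'c::comm_ring_1"
  shows "transform (\<lambda>a. (if a = 0 then 2 else 0) - f a) b = 2 - transform f b"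
proof -
  have "(if a = 0 then 2 else 0) * of_int (\<psi> (a * b)) = (if a = 0 then 2 else 0 :: 'c)" for a
    by simp
  then show ?thesis
    by (simp add: transform_def left_diff_distrib sum_subtractf)
qed

text \<open>The witness \<open>k\<close> counts the \<open>a\<close> in \<open>D\<close> with
  \<open>\<psi> (a * b) = -1\<close>; the product of these values is \<open>\<psi>\<close> of their
  summed arguments.\<close>

lemma sum_over_set_parity:
  "\<exists>k::nat. (\<Sum>a\<in>D. \<psi> (a * b)) = int (card D) - 2 * int k \<and> (-1) ^ k = \<psi> (\<Sum>D * b)"
proof -
  have "finite D"
    by simp
  then show ?thesis
  proof (induction D)
    case empty
    then show ?case
      by (intro exI[of _ 0]) simp
  next
    case (insert a D)
    then obtain k :: nat where k: "(\<Sum>a\<in>D. \<psi> (a * b)) = int (card D) - 2 * int k"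
        "(-1) ^ k = \<psi> (\<Sum>D * b)"
      by blast
    have "\<psi> (\<Sum>(insert a D) * b) = \<psi> (a * b) * (-1) ^ k"
      using insert.hyps by (simp add: distrib_right add k)
    then show ?case
      using insert.hyps k range[of "a * b"]
      by (intro exI[of _ "if \<psi> (a * b) = 1 then k else Suc k"]) auto
  qed
qed

text \<open>The parity of \<open>u\<close> is governed by a single character value because \<open>\<psi>\<close> turns the product
  over the negative positions of \<open>\<epsilon>\<close> into its value at their sum.\<close>

lemma transform_sign_parity:
  fixes \<epsilon> :: "'b \<Rightarrow> int"
  assumes sign: "\<And>a. \<epsilon> a \<in> {1, -1}"
    and even: "even (card {a. \<epsilon> a = -1})"
    and card: "8 dvd CARD('b)"
  obtains u :: "'b \<Rightarrow> int" and c :: 'b and \<sigma> :: int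
  where "\<And>b. transform \<epsilon> b = 4 * u b"
    and "\<sigma> \<in> {1, -1}"
    and "\<And>b. (if even (u b) then 1 else -1) = \<sigma> * \<psi> (c * b)"
proof -
  define D where "D = {a. \<epsilon> a = -1}"
  obtain d where d: "card D = 2 * d"
    using even by (auto simp: D_def)
  obtain q where q: "CARD('b) = 8 * q"
    using card by blast
  have "\<forall>b. \<exists>k::nat. (\<Sum>a\<in>D. \<psi> (a * b)) = int (card D) - 2 * int k \<and> (-1) ^ k = \<psi> (\<Sum>D * b)"
    using sum_over_set_parity by blast
  then obtain k :: "'b \<Rightarrow> nat"
    where k: "\<And>b. (\<Sum>a\<in>D. \<psi> (a * b)) = int (card D) - 2 * int (k b)"
      and parity: "\<And>b. (-1) ^ k b = \<psi> (\<Sum>D * b)"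
    by metis
  \<comment> \<open>A quarter of the full character sum minus twice the sum over \<open>D\<close>.
    Divisibility by 8 makes the term at 0 even, so the parity of \<open>u b\<close> is that of
    \<open>d + k b\<close>.\<close>
  define u where "u b = (if b = 0 then 2 * int q else 0) - int d + int (k b)" for b
  have "transform \<epsilon> b = 4 * u b" for b
  proof -
    have "\<epsilon> a * \<psi> (a * b) = \<psi> (b * a) - 2 * (if a \<in> D then \<psi> (a * b) else 0)" for a
      using sign[of a] by (auto simp: D_def mult.commute)
    then have "transform \<epsilon> b = (\<Sum>a\<in>UNIV. \<psi> (b * a)) - 2 * (\<Sum>a\<in>D. \<psi> (a * b))"
      by (simp add: transform_def sum_subtractf sum_distrib_left[symmetric] sum.If_cases)
    then show ?thesis
      by (simp add: sum_mult_left k u_def d q)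
  qed
  moreover have "(if even (u b) then 1 else -1) = (-1) ^ d * \<psi> (\<Sum>D * b)" for b
    by (simp add: parity[symmetric] u_def minus_one_power_iff)
  moreover have "(-1) ^ d \<in> {1, -1 :: int}"
    by (simp add: minus_one_power_iff)
  ultimately show ?thesis
    using that by blast
qed

end

section \<open>Integer multisets with prescribed sums\<close>

lemma multiset_eq_sum_replicate:
  fixes M :: "int multiset"
  assumes "set_mset M \<subseteq> {-4..4}"
  shows "M = replicate_mset (count M (-4)) (-4) + replicate_mset (count M (-3)) (-3)
    + replicate_mset (count M (-2)) (-2) + replicate_mset (count M (-1)) (-1)
    + replicate_mset (count M 0) 0 + replicate_mset (count M 1) 1
    + replicate_mset (count M 2) 2 + replicate_mset (count M 3) 3 + replicate_mset (count M 4) 4"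
    (is "M = ?N")
proof (rule multiset_eqI)
  fix x
  show "count M x = count ?N x"
  proof (cases "x \<in> {-4..4}")
    case True
    then have "-4 \<le> x \<and> x \<le> 4"
      by simp
    then have "x = -4 \<or> x = -3 \<or> x = -2 \<or> x = -1 \<or> x = 0 \<or> x = 1 \<or> x = 2 \<or> x = 3 \<or> x = 4"
      by presburger
    then show ?thesis
      by auto
  next
    case False
    then have "x \<notin># M"
      using assms by blast
    moreover from False have "x \<noteq> -4" "x \<noteq> -3" "x \<noteq> -2" "x \<noteq> -1" "x \<noteq> 0" "x \<noteq> 1"
      "x \<noteq> 2" "x \<noteq> 3" "x \<noteq> 4"
      by auto
    ultimately show ?thesis
      by (simp add: not_in_iff)
  qed
qed

text \<open>The square sum confines entries to absolute value at most 4, so only nine multiplicities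
  are unknown; the sums become linear equations in them.\<close>

lemma double_in_basic_solutions:
  fixes M :: "int multiset"
  assumes size: "size M = 16"
    and sum: "(\<Sum>x\<in>#M. x) = 4"
    and sum_sq: "(\<Sum>x\<in>#M. x\<^sup>2) = 16"
    and sum_sgn: "(\<Sum>x\<in>#M. if even x then 1 else -1) \<in> {0, 16, -16 :: int}"
    and sum_alt: "(\<Sum>x\<in>#M. (if even x then 1 else -1) * x) \<in> {4, -4}"
  shows "image_mset ((*) 2) M \<in> basic_solutions"
proof -
  have "x \<in> {-4..4}" if "x \<in># M" for x
  proof -
    obtain N where N: "M = add_mset x N"
      using multi_member_split[OF \<open>x \<in># M\<close>] by blast
    have "0 \<le> (\<Sum>y\<in>#N. y\<^sup>2)"
      by (induction N) auto
    then have "x\<^sup>2 \<le> 4\<^sup>2"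
      using sum_sq by (simp add: N)
    then show ?thesis
      using abs_le_square_iff[of x 4] by auto
  qed
  then have "set_mset M \<subseteq> {-4..4}"
    by blast
  from multiset_eq_sum_replicate[OF this]
  obtain m4 m3 m2 m1 z p1 p2 p3 p4 where M: "M = replicate_mset m4 (-4) + replicate_mset m3 (-3)
    + replicate_mset m2 (-2) + replicate_mset m1 (-1) + replicate_mset z 0 + replicate_mset p1 1
    + replicate_mset p2 2 + replicate_mset p3 3 + replicate_mset p4 4"
    by blast
  have size': "m4 + m3 + m2 + m1 + z + p1 + p2 + p3 + p4 = 16"
    using size by (simp add: M)
  have sum': "4 * p4 + 3 * p3 + 2 * p2 + p1 = 4 * m4 + 3 * m3 + 2 * m2 + m1 + 4"
    using sum by (simp add: M)
  have sq': "16 * m4 + 16 * p4 + 9 * m3 + 9 * p3 + 4 * m2 + 4 * p2 + m1 + p1 = 16"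
    using sum_sq by (simp add: M)
  have odd: "m3 + m1 + p1 + p3 \<in> {0, 8, 16}"
    using sum_sgn size' by (auto simp: M)
  \<comment> \<open>The even and odd entries have total 4 and difference
    \<open>\<plusminus>4\<close>, so the even ones sum to 0 or 4.\<close>
  have even: "2 * p4 + p2 = 2 * m4 + m2 \<or> 2 * p4 + p2 = 2 * m4 + m2 + 2"
    using sum_alt sum' by (auto simp: M)
  consider (none) "m3 + m1 + p1 + p3 = 0" | (half) "m3 + m1 + p1 + p3 = 8"
    | (all) "m3 + m1 + p1 + p3 = 16"
    using odd by blast
  \<comment> \<open>The tuples are the basic solutions, halved, in their original order.\<close>
  then have "(m4, m3, m2, m1, z, p1, p2, p3, p4) \<in>
    {(0, 1, 0, 0, 8, 7, 0, 0, 0), (0, 0, 1, 2, 6, 6, 1, 0, 0), (0, 0, 1, 0, 12, 0, 3, 0, 0),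
     (0, 0, 0, 6, 0, 10, 0, 0, 0), (0, 0, 0, 4, 6, 4, 2, 0, 0), (0, 0, 0, 3, 8, 4, 0, 1, 0),
     (0, 0, 0, 0, 15, 0, 0, 0, 1)}"
  proof cases
    case none
    then have zeros: "m3 = 0" "m1 = 0" "p1 = 0" "p3 = 0"
      by auto
    have "m4 + p4 \<le> 1"
      using sq' by linarith
    then consider "m4 + p4 = 0" | "m4 + p4 = 1"
      by linarith
    then show ?thesis
    proof cases
      case 1
      then have "m4 = 0" "p4 = 0" "m2 = 1" "p2 = 3" "z = 12"
        using sum' sq' size' none zeros by linarith+
      then show ?thesis
        by (simp add: zeros)
    next
      case 2
      then have "m4 = 0" "p4 = 1" "m2 = 0" "p2 = 0" "z = 15"
        using sum' sq' size' none zeros by linarith+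
      then show ?thesis
        by (simp add: zeros)
    qed
  next
    case half
    \<comment> \<open>Eight odd entries use at least 8 of the square sum 16. An entry
      \<open>\<plusminus>3\<close> costs 8 more, so at most one fits, and
      \<open>\<plusminus>4\<close> does not fit.\<close>
    then have "m4 = 0" "p4 = 0" "m3 + p3 \<le> 1"
      using sq' by linarith+
    then consider "m3 = 0" "p3 = 0" | "m3 = 1" "p3 = 0" | "m3 = 0" "p3 = 1"
      by linarith
    then show ?thesis
    proof cases
      case 1
      then have "m2 + p2 = 2"
        using sq' half \<open>m4 = 0\<close> \<open>p4 = 0\<close> by linarith
      \<comment> \<open>The condition on the even entries excludes two entries equal to -2.\<close>
      then consider "m2 = 1" "p2 = 1" | "m2 = 0" "p2 = 2"
        using even \<open>m4 = 0\<close> \<open>p4 = 0\<close> by linarith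
      then show ?thesis
        using sum' size' half 1 \<open>m4 = 0\<close> \<open>p4 = 0\<close> by cases auto
    next
      case 2
      then have "m2 = 0" "p2 = 0"
        using sq' half by linarith+
      then show ?thesis
        using sum' size' half 2 \<open>m4 = 0\<close> \<open>p4 = 0\<close> by auto
    next
      case 3
      then have "m2 = 0" "p2 = 0"
        using sq' half by linarith+
      then show ?thesis
        using sum' size' half 3 \<open>m4 = 0\<close> \<open>p4 = 0\<close> by auto
    qed
  next
    case all
    then have "m4 = 0" "p4 = 0" "m3 = 0" "p3 = 0" "m2 = 0" "p2 = 0"
      using sq' by auto
    then show ?thesis
      using sum' size' all by auto
  qed
  then show ?thesis
    by (auto simp: M basic_solutions_def ac_simps)
qed

section \<open>Transforms of sign functions on sixteen points\<close>

context sign_character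
begin

lemma transform_sign_in_solutions:
  fixes \<epsilon> :: "'b \<Rightarrow> int"
  assumes sign: "\<And>a. \<epsilon> a \<in> {1, -1}"
    and zero: "\<epsilon> 0 = 1"
    and card: "CARD('b) = 16"
  obtains T :: "'b \<Rightarrow> int"
  where "\<And>b. transform \<epsilon> b = 2 * T b" and "image_mset T (mset_set UNIV) \<in> solutions"
proof -
  have even_case: "\<exists>T. (\<forall>b. transform \<epsilon> b = 2 * T b) \<and> image_mset T (mset_set UNIV) \<in> basic_solutions"
    if sign: "\<And>a. \<epsilon> a \<in> {1, -1}" and zero: "\<epsilon> 0 = 1" and even: "even (card {a. \<epsilon> a = -1})"
    for \<epsilon> :: "'b \<Rightarrow> int"
  proof -
    obtain u :: "'b \<Rightarrow> int" and c \<sigma> where u: "\<And>b. transform \<epsilon> b = 4 * u b"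
      and \<sigma>: "\<sigma> \<in> {1, -1}"
      and parity: "\<And>b. (if even (u b) then 1 else -1) = \<sigma> * \<psi> (c * b)"
    proof (rule transform_sign_parity[OF sign even])
      show "8 dvd CARD('b)"
        by (simp add: card)
    qed (rule that)
    let ?M = "image_mset u (mset_set UNIV)"
    have M: "(\<Sum>x\<in>#?M. g x) = (\<Sum>b\<in>UNIV. g (u b))" for g :: "int \<Rightarrow> int"
      by (simp add: sum_unfold_sum_mset multiset.map_comp comp_def)
    have sq: "(\<epsilon> a)\<^sup>2 = 1" for a
      using sign[of a] by auto
    have "4 * (\<Sum>b\<in>UNIV. u b) = 16"
      using sum_transform[of \<epsilon>] by (simp add: u card zero sum_distrib_left)
    then have sum: "(\<Sum>x\<in>#?M. x) = 4"
      by (simp only: M)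
    have "16 * (\<Sum>b\<in>UNIV. (u b)\<^sup>2) = 256"
      using sum_transform_squared[of \<epsilon>]
      by (simp add: u card sq power_mult_distrib sum_distrib_left)
    then have sum_sq: "(\<Sum>x\<in>#?M. x\<^sup>2) = 16"
      by (simp only: M)
    have "(\<Sum>b\<in>UNIV. if even (u b) then 1 else -1) = \<sigma> * (\<Sum>b\<in>UNIV. \<psi> (c * b))"
      by (simp only: parity sum_distrib_left)
    then have sum_sgn: "(\<Sum>x\<in>#?M. if even x then 1 else -1) \<in> {0, 16, -16 :: int}"
      using \<sigma> by (simp only: M) (auto simp: sum_mult_left card)
    \<comment> \<open>Weighting by parity is weighting by a character, so this sum is a second
      transform at \<open>c\<close>, and inversion leaves one sign.\<close>
    have "4 * (\<Sum>b\<in>UNIV. (if even (u b) then 1 else -1) * u b) = \<sigma> * transform (transform \<epsilon>) c"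
      by (simp only: parity transform_def[of "transform \<epsilon>"] u sum_distrib_left) (simp add: mult_ac)
    also have "\<dots> = 16 * (\<sigma> * \<epsilon> c)"
      by (simp add: transform_transform card)
    finally have sum_alt: "(\<Sum>x\<in>#?M. (if even x then 1 else -1) * x) \<in> {4, -4}"
      using \<sigma> sign[of c] by (simp only: M) auto
    have "image_mset ((*) 2) ?M \<in> basic_solutions"
      using double_in_basic_solutions[OF _ sum sum_sq sum_sgn sum_alt] card by simp
    then show ?thesis
      using u by (intro exI[of _ "\<lambda>b. 2 * u b"]) (simp add: multiset.map_comp comp_def)
  qed
  show ?thesis
  proof (cases "even (card {a. \<epsilon> a = -1})")
    case True
    then show ?thesis
      using even_case[of \<epsilon>] sign zero that unfolding solutions_def by blast
  next
    case False
    define \<epsilon>' where "\<epsilon>' a = (if a = 0 then 2 else 0) - \<epsilon> a" for a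
    have sign': "\<epsilon>' a \<in> {1, -1}" for a
      using sign[of a] by (auto simp: \<epsilon>'_def zero)
    \<comment> \<open>Its size is 16 minus an odd number minus 1, hence even.\<close>
    have "{a. \<epsilon>' a = -1} = UNIV - insert 0 {a. \<epsilon> a = -1}"
      using sign by (auto simp: \<epsilon>'_def zero)
    moreover have "card (insert 0 {a. \<epsilon> a = -1}) = Suc (card {a. \<epsilon> a = -1})"
      by (rule card_insert_disjoint) (auto simp: zero)
    moreover have "card (insert 0 {a. \<epsilon> a = -1}) \<le> CARD('b)"
      by (rule card_mono) auto
    ultimately have "even (card {a. \<epsilon>' a = -1})"
      using False by (simp add: card_Diff_subset card)
    moreover have "\<epsilon>' 0 = 1"
      by (simp add: \<epsilon>'_def zero)
    ultimately obtain T where T: "\<And>b. transform \<epsilon>' b = 2 * T b"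
        "image_mset T (mset_set UNIV) \<in> basic_solutions"
      using even_case[of \<epsilon>'] sign' by blast
    have "transform \<epsilon> b = 2 * (- T b + 1)" for b
      using transform_flip[of \<epsilon> b] T(1)[of b] by (simp add: \<epsilon>'_def[abs_def])
    moreover have "image_mset (\<lambda>b. - T b + 1) (mset_set UNIV) =
        image_mset (\<lambda>t. - t + 1) (image_mset T (mset_set UNIV))"
      by (simp add: multiset.map_comp comp_def)
    then have "image_mset (\<lambda>b. - T b + 1) (mset_set UNIV) \<in> solutions"
      using T(2) unfolding solutions_def by blast
    ultimately show ?thesis
      by (rule that)
  qed
qed

end

section \<open>Character sums and preimage sizes of bent functions\<close>

lemma sum_fibres:
  fixes g :: "'b::finite \<Rightarrow> 'c::comm_semiring_1" and G :: "'a::finite \<Rightarrow> 'b"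
  shows "(\<Sum>x\<in>UNIV. g (G x)) = (\<Sum>b\<in>UNIV. of_nat (card (G -` {b})) * g b)"
proof -
  have "(\<Sum>x\<in>UNIV. g (G x)) = (\<Sum>b\<in>UNIV. \<Sum>x\<in>{x \<in> UNIV. G x = b}. g (G x))"
    by (rule sum.group[symmetric]) auto
  also have "\<dots> = (\<Sum>b\<in>UNIV. of_nat (card (G -` {b})) * g b)"
    by (intro sum.cong) (simp_all add: vimage_def)
  finally show ?thesis .
qed

text \<open>The square is a sum over shifts \<open>d\<close> of character sums of derivatives. For
  \<open>d \<noteq> 0\<close> all fibres of the derivative have equal size, so orthogonality kills
  the term; only \<open>d = 0\<close> remains.\<close>

lemma (in sign_character) bent_character_sum_squared:
  fixes F :: "'a::{field,finite} \<Rightarrow> 'b"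
  assumes bent: "bent n m F" and "a \<noteq> 0"
  shows "(\<Sum>x\<in>UNIV. \<psi> (a * F x))\<^sup>2 = int CARD('a)"
proof -
  have vanish: "(\<Sum>x\<in>UNIV. \<psi> (a * (F (x + d) - F x))) = 0" if "d \<noteq> 0" for d
  proof -
    let ?N = "\<lambda>b. card ((\<lambda>x. F (x + d) - F x) -` {b})"
    have "real (?N b) = 2 powr (real n - real m)" for b
      using bent \<open>d \<noteq> 0\<close> by (simp add: bent_def vimage_def)
    then obtain \<kappa> where "\<And>b. ?N b = \<kappa>"
      by (metis of_nat_eq_iff)
    then show ?thesis
      using sum_mult_left[of a] \<open>a \<noteq> 0\<close>
      by (simp add: sum_fibres[of "\<lambda>b. \<psi> (a * b)" "\<lambda>x. F (x + d) - F x"] sum_distrib_left[symmetric])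
  qed
  have "(\<Sum>x\<in>UNIV. \<psi> (a * F x))\<^sup>2 = (\<Sum>x\<in>UNIV. \<Sum>y\<in>UNIV. \<psi> (a * (F y - F x)))"
    by (simp add: power2_eq_square sum_product right_diff_distrib diff mult.commute)
  also have "\<dots> = (\<Sum>x\<in>UNIV. \<Sum>d\<in>UNIV. \<psi> (a * (F (x + d) - F x)))"
  proof (rule sum.cong)
    fix x
    show "(\<Sum>y\<in>UNIV. \<psi> (a * (F y - F x))) = (\<Sum>d\<in>UNIV. \<psi> (a * (F (x + d) - F x)))"
      by (rule sum.reindex_bij_witness[of _ "\<lambda>d. x + d" "\<lambda>y. y - x"]) auto
  qed simp
  also have "\<dots> = (\<Sum>d\<in>UNIV. \<Sum>x\<in>UNIV. \<psi> (a * (F (x + d) - F x)))"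
    by (rule sum.swap)
  also have "\<dots> = (\<Sum>d\<in>(UNIV :: 'a set). if d = 0 then int CARD('a) else 0)"
    by (intro sum.cong) (auto simp: vanish)
  finally show ?thesis
    by simp
qed

lemma preimage_distribution_bent:
  fixes F :: "'a::{field,finite} \<Rightarrow> 'b::{field,finite}"
  assumes card_a: "CARD('a) = 2 ^ n" and card_b: "CARD('b) = 2 ^ 4" and bent: "bent n 4 F"
  shows "image_mset real (preimage_distribution F) \<in> sizes_of_solution n ` solutions"
proof -
  obtain \<psi> :: "'b \<Rightarrow> int" where "sign_character \<psi>"
    using exists_sign_character[OF card_b] by blast
  then interpret sign_character \<psi> .
  define S where "S a = (\<Sum>x\<in>UNIV. \<psi> (a * F x))" for a
  define r :: real where "r = 2 powr (n / 2)"
  have r_sq: "r\<^sup>2 = 2 ^ n"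
    by (simp add: r_def power2_eq_square powr_add[symmetric] powr_realpow)
  have "r > 0"
    by (simp add: r_def)
  define \<epsilon> :: "'b \<Rightarrow> int" where "\<epsilon> a = (if a = 0 \<or> S a > 0 then 1 else -1)" for a
  \<comment> \<open>\<open>S 0\<close> is the domain size \<open>r\<^sup>2\<close>, whereas
    \<open>\<epsilon> 0 = 1\<close> contributes \<open>r\<close>. The correction at 0 has constant
    transform, which yields the mean and the -1 in \<open>2 * T b - 1\<close>.\<close>
  have S_eq: "of_int (S a) = r * \<epsilon> a + (if a = 0 then r\<^sup>2 - r else 0)" for a
  proof (cases "a = 0")
    case True
    then show ?thesis
      by (simp add: S_def \<epsilon>_def card_a r_sq)
  next
    case False
    then have "(S a)\<^sup>2 = 2 ^ n"
      using bent_character_sum_squared[OF bent] card_a by (simp add: S_def)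
    then have "(real_of_int (S a))\<^sup>2 = r\<^sup>2"
      unfolding r_sq by (metis of_int_numeral of_int_power)
    then have "real_of_int (S a) = r \<or> real_of_int (S a) = - r"
      by (simp add: power2_eq_iff)
    then show ?thesis
      using False \<open>r > 0\<close> by (auto simp: \<epsilon>_def)
  qed
  obtain T where T: "\<And>b. transform \<epsilon> b = 2 * T b" and sol: "image_mset T (mset_set UNIV) \<in> solutions"
    by (rule transform_sign_in_solutions[of \<epsilon>]) (simp_all add: \<epsilon>_def card_b)
  have size: "real (card (F -` {b})) = 2 powr (real n - 4) + 2 powr (real n / 2 - 4) * (2 * T b - 1)" for b
  proof -
    let ?P = "\<lambda>b. real (card (F -` {b}))"
    have "transform ?P a = of_int (S a)" for a
      using sum_fibres[of "\<lambda>b. real_of_int (\<psi> (b * a))" F]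
      by (simp add: transform_def S_def mult.commute)
    \<comment> \<open>The character sums are the transform of the preimage sizes, so inversion
      recovers the sizes.\<close>
    then have "16 * ?P b = transform (\<lambda>a. of_int (S a)) b"
      using transform_transform[of ?P b] card_b
      by (simp add: transform_def[of "transform ?P"] transform_def[of "\<lambda>a. of_int (S a)"])
    also have "\<dots> = (\<Sum>a\<in>UNIV. r * (\<epsilon> a * \<psi> (a * b)) + (if a = 0 then r\<^sup>2 - r else 0))"
      unfolding transform_def S_eq by (intro sum.cong) (auto simp: algebra_simps)
    also have "\<dots> = r * of_int (transform \<epsilon> b) + (r\<^sup>2 - r)"
      by (simp add: sum.distrib transform_def sum_distrib_left)
    finally have "?P b = r\<^sup>2 / 16 + r / 16 * (2 * T b - 1)"
      by (simp add: T field_simps)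
    moreover have "2 powr (real n - 4) = r\<^sup>2 / 16"
      by (simp add: powr_diff r_sq powr_realpow)
    moreover have "2 powr (real n / 2 - 4) = r / 16"
      by (simp add: powr_diff r_def)
    ultimately show ?thesis
      by (simp only:)
  qed
  have "image_mset real (preimage_distribution F) = sizes_of_solution n (image_mset T (mset_set UNIV))"
    by (simp add: preimage_distribution_def sizes_of_solution_def multiset.map_comp comp_def size)
  then show ?thesis
    using sol by blast
qed

section \<open>Counting the distributions\<close>

text \<open>Sizes are affine in \<open>t\<close> with nonzero slope, so distinct solutions give
  distinct distributions.\<close>

lemma inj_sizes_of_solution: "inj (sizes_of_solution n)"
proof -
  have "inj (\<lambda>t. 2 powr (real n - 4) + 2 powr (real n / 2 - 4) * (2 * real_of_int t - 1))"
    by (rule injI) simp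
  then show ?thesis
    unfolding sizes_of_solution_def[abs_def] by (rule multiset.inj_map)
qed

text \<open>The fourth power sums of \<open>t + 2\<close> separate the solutions.\<close>

lemma card_solutions: "card solutions = 14"
proof -
  let ?g = "\<lambda>M. \<Sum>t\<in>#M. (t + 2 :: int) ^ 4"
  \<comment> \<open>All solutions share size 16, sum 8 and square sum 64; the shifted fourth power
    combines their third and fourth moments.\<close>
  have "?g ` solutions = {2176, 2944, 4096, 2560, 3712, 5248, 10240, 7216, 4144, 3376, 3760, 2992, 2608, 1840}"
    by (simp add: solutions_def basic_solutions_def insert_commute)
  then have "14 \<le> card solutions"
    using card_image_le[of solutions ?g] by (simp add: solutions_def basic_solutions_def)
  moreover have "card solutions \<le> 14"
  proof -
    have "card basic_solutions \<le> 7"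
      unfolding basic_solutions_def by (intro card_insert_le_m1) auto
    moreover have "finite basic_solutions"
      by (simp add: basic_solutions_def)
    ultimately show ?thesis
      unfolding solutions_def
      using card_Un_le[of basic_solutions "image_mset (\<lambda>t. - t + 1) ` basic_solutions"]
        card_image_le[of basic_solutions "image_mset (\<lambda>t. - t + 1)"]
      by linarith
  qed
  ultimately show ?thesis
    by simp
qed

theorem theorem5p7:
  fixes F :: "'a::{field,finite} \<Rightarrow> 'b::{field,finite}" and n :: nat
  assumes "CARD('a) = 2 ^ n"
    and "CARD('b) = 2 ^ 4"
    and "bent n 4 F"
  shows "image_mset real (preimage_distribution F) \<in> sizes_of_solution n ` solutions
         \<and> card (sizes_of_solution n ` solutions) = 14"
  using preimage_distribution_bent[OF assms] card_solutions
    card_image[OF inj_on_subset[OF inj_sizes_of_solution subset_UNIV]] by simp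

end
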